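(* Let $D$ be a loopless graph on $n$ vertices. Then $\mathrm{s}_+[D^\circ, 2] = n-1$ if and only if $D$ is a non-empty near-biclique.
   Context: Graphs are finite and directed: $D=(V,E)$ with $V=\{1,\dots,n\}$, $n\ge1$, $E\subseteq V^2$. $D$ is loopless if it has no arc $(v,v)$; $D$ is non-empty if it has at least one arc. For loopless $D$, $D^\circ$ is obtained from $D$ by adding a loop on every vertex. $N(v)=\{u:(u,v)\in E\}$ is the in-neighbourhood of $v$ in $D$; a source of $D$ is a vertex $v$ with $N(v)=\emptyset$. A loopless graph $D$ is a near-biclique if its vertex set can be partitioned as $V=A\cup B\cup S$ (parts are allowed to be empty), where $S$ is the set of sources of $D$, and 1. for all distinct $a_1,a_2\in A$, $(a_1,a_2)\in E$ or $(a_2,a_1)\in E$ (or both); 2. for all distinct $b_1,b_2\in B$, $(b_1,b_2)\in E$ or $(b_2,b_1)\in E$ (or both); 3. for any $u,v\in V\setminus S$, there exists $w\in (N(u)\cup\{u\})\cap(N(v)\cup\{v\})$; 4. for any $a\in A$ and $b\in B$, there exists $w\in N(a)\cap N(b)$. Let $[2]=\{0,1\}$. For $f=(f_1,\dots,f_n):[2]^n\to[2]^n$, the interaction graph $G(f)$ has vertex set $V$ and an arc $(u,v)$ if and only if there exist $x,y\in[2]^n$ differing only in coordinate $u$ with $f_v(x)\ne f_v(y)$. $\mathrm{F}_+[H,2]$ is the set of all $f:[2]^n\to[2]^n$ with $G(f)=H$ that are monotone, i.e. $x\le y$ coordinatewise implies $f(x)\le f(y)$ coordinatewise. With $d_{\mathrm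 H}$ the Hamming distance, $\mathrm{s}(f)=\min_{x\in[2]^n}(n-d_{\mathrm H}(x,f(x)))$ and $\mathrm{s}_+[H,2]=\max_{f\in\mathrm{F}_+[H,2]}\mathrm{s}(f)$. *)

theory Defs
  imports "HOL-Library.Cardinality"
begin

text \<open>
  The vertex set is the finite (nonempty) type \<open>'v\<close>, so \<open>n = CARD('v)\<close>, and a graph is
  its set of arcs. A configuration in \<open>[2]^n\<close> is a function \<open>'v \<Rightarrow> bool\<close>, with \<open>False\<close> for
  \<open>0\<close> and \<open>True\<close> for \<open>1\<close>; the library order on this type is the coordinatewise one, so
  monotone networks are those satisfying \<^const>\<open>mono\<close>.
\<close>

type_synonym 'v graph = "('v \<times> 'v) set"

type_synonym 'v config = "'v \<Rightarrow> bool"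

definition loopless :: "'v graph \<Rightarrow> bool" where
  "loopless E \<longleftrightarrow> (\<forall>v. (v, v) \<notin> E)"

definition add_loops :: "'v graph \<Rightarrow> 'v graph" where
  "add_loops E = E \<union> {(v, v) | v. True}"

definition in_nbhd :: "'v graph \<Rightarrow> 'v \<Rightarrow> 'v set" where
  "in_nbhd E v = {u. (u, v) \<in> E}"

definition sources :: "'v graph \<Rightarrow> 'v set" where
  "sources E = {v. in_nbhd E v = {}}"

definition near_biclique :: "'v graph \<Rightarrow> bool" where
  "near_biclique E \<longleftrightarrow>
     loopless E \<and>
     (\<exists>A B S.
        A \<union> B \<union> S = UNIV \<and> A \<inter> B = {} \<and> A \<inter> S = {} \<and> B \<inter> S = {} \<and>
        S = sources E \<and>
        (\<forall>a1\<in>A. \<forall>a2\<in>A. a1 \<noteq> a2 \<longrightarrow> (a1, a2) \<in> E \<or> (a2, a1) \<in> E) \<and>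
        (\<forall>b1\<in>B. \<forall>b2\<in>B. b1 \<noteq> b2 \<longrightarrow> (b1, b2) \<in> E \<or> (b2, b1) \<in> E) \<and>
        (\<forall>u\<in>UNIV - S. \<forall>v\<in>UNIV - S.
           \<exists>w. w \<in> (in_nbhd E u \<union> {u}) \<inter> (in_nbhd E v \<union> {v})) \<and>
        (\<forall>a\<in>A. \<forall>b\<in>B. \<exists>w. w \<in> in_nbhd E a \<inter> in_nbhd E b))"

definition interaction_graph :: "('v config \<Rightarrow> 'v config) \<Rightarrow> 'v graph" where
  "interaction_graph f =
     {(u, v). \<exists>x y. (\<forall>w. w \<noteq> u \<longrightarrow> x w = y w) \<and> x u \<noteq> y u \<and> f x v \<noteq> f y v}"

definition mono_networks :: "'v graph \<Rightarrow> ('v config \<Rightarrow> 'v config) set" where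
  "mono_networks H = {f. interaction_graph f = H \<and> mono f}"

definition hamming_dist :: "'v config \<Rightarrow> 'v config \<Rightarrow> nat" where
  "hamming_dist x y = card {v. x v \<noteq> y v}"

definition stability :: "('v::finite config \<Rightarrow> 'v config) \<Rightarrow> nat" where
  "stability f = Min ((\<lambda>x. CARD('v) - hamming_dist x (f x)) ` UNIV)"

definition max_mono_stability :: "'v::finite graph \<Rightarrow> nat" where
  "max_mono_stability H = Max (stability ` mono_networks H)"

text \<open>
  The maximum is over a nonempty finite set and the subtraction on \<^typ>\<open>nat\<close> never truncates.
\<close>

lemma mono_networks_nonempty: "mono_networks H \<noteq> {}"
proof -
  define f :: "'a config \<Rightarrow> 'a config" where "f = (\<lambda>x v. \<exists>u. (u, v) \<in> H \<and> x u)"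
  have "mono f"
    by (auto simp: f_def mono_def le_fun_def)
  moreover have "interaction_graph f = H"
  proof (intro equalityI subrelI)
    fix u v assume "(u, v) \<in> interaction_graph f"
    then show "(u, v) \<in> H"
      by (auto simp: interaction_graph_def f_def)
  next
    fix u v assume "(u, v) \<in> H"
    then have "f (\<lambda>w. w = u) v \<noteq> f (\<lambda>w. False) v"
      by (simp add: f_def)
    moreover have "\<forall>w. w \<noteq> u \<longrightarrow> (w = u) = False"
      by simp
    ultimately show "(u, v) \<in> interaction_graph f"
      unfolding interaction_graph_def
      by (intro CollectI case_prodI exI[of _ "\<lambda>w. w = u"] exI[of _ "\<lambda>w. False"] conjI) simp_all
  qed
  ultimately show ?thesis
    by (auto simp: mono_networks_def)
qed

lemma finite_mono_networks: "finite (mono_networks (H :: 'v::finite graph))"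
  by simp

lemma hamming_dist_le: "hamming_dist x y \<le> CARD('v)" for x y :: "'v::finite config"
  unfolding hamming_dist_def by (rule card_mono) simp_all

end

theory Submission
  imports Defs
begin

text \<open>
  Stability \<open>n - 1\<close> means that a network other than the identity has at most one unstable
  coordinate in every configuration. Given such a network, let \<open>A\<close> be the non-sources that can be
  pushed from 0 to 1, and \<open>B\<close> the remaining non-sources, which can be pushed from 1 to 0. By
  monotonicity a vertex of \<open>A\<close> is pushed up as soon as all its in-neighbours are 1, and a vertex of
  \<open>B\<close> is pushed down as soon as they are all 0. So two vertices violating a near-biclique condition
  would be unstable simultaneously. Conversely, on a near-biclique, the network that takes the
  conjunction of the in-neighbours on \<open>A\<close> and their disjunction on \<open>B\<close> (combined with the vertex
  itself so that it moves in one direction only) has at most one unstable coordinate.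
\<close>

section \<open>Interaction graphs and the coordinates they let a component read\<close>

lemma mono_configD: "\<lbrakk>mono f; x \<le> y; f x v\<rbrakk> \<Longrightarrow> f y v"
  for f :: "'v config \<Rightarrow> 'v config"
  by (auto simp: mono_def le_fun_def)

lemma interaction_graphI:
  assumes "f (x(u := True)) v \<noteq> f (x(u := False)) v"
  shows "(u, v) \<in> interaction_graph f"
  unfolding interaction_graph_def using assms
  by (intro CollectI case_prodI exI[of _ "x(u := True)"] exI[of _ "x(u := False)"] conjI) simp_all

text \<open>Turn \<open>x\<close> into \<open>y\<close> one coordinate at a time, \<open>T\<close>
  being the set already switched: a switch that changes anything happens at a coordinate without an
  arc into \<open>v\<close>.\<close>

lemma interaction_graph_agree:
  fixes f :: "('v::finite) config \<Rightarrow> 'v config"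
  assumes agree: "\<And>u. (u, v) \<in> interaction_graph f \<Longrightarrow> x u = y u"
  shows "f x v = f y v"
proof -
  have "f (\<lambda>w. if w \<in> T then y w else x w) v = f x v" if "finite T" for T
    using that
  proof (induction T rule: finite_induct)
    case (insert t T)
    define p q where "p = (\<lambda>w. if w \<in> T then y w else x w)"
      and "q = (\<lambda>w. if w \<in> insert t T then y w else x w)"
    have off: "q w = p w" if "w \<noteq> t" for w
      using that by (simp add: p_def q_def)
    have "f q v = f p v"
    proof (cases "q t = p t")
      case True
      have "q = p"
      proof
        show "q w = p w" for w using True off by (cases "w = t") auto
      qed
      then show ?thesis by simp
    next
      case False
      then have "x t \<noteq> y t"
        by (auto simp: p_def q_def split: if_splits)
      then have "(t, v) \<notin> interaction_graph f"
        using agree by blast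
      then have "\<not> ((\<forall>w. w \<noteq> t \<longrightarrow> q w = p w) \<and> q t \<noteq> p t \<and> f q v \<noteq> f p v)"
        by (simp add: interaction_graph_def)
      then show ?thesis using off False by simp
    qed
    with insert.IH show ?case by (simp add: p_def q_def)
  qed simp
  from this[of UNIV] show ?thesis by simp
qed

section \<open>Stability as a bound on the unstable coordinates\<close>

lemma stability_ge_iff:
  "k \<le> stability f \<longleftrightarrow> (\<forall>x. k \<le> CARD('v) - hamming_dist x (f x))"
  for f :: "('v::finite) config \<Rightarrow> 'v config"
  unfolding stability_def by (subst Min_ge_iff) auto

lemma stability_le: "stability f \<le> CARD('v)" for f :: "('v::finite) config \<Rightarrow> 'v config"
  using stability_ge_iff[of "stability f" f] by (metis diff_le_self le_trans order_refl)

lemma stability_ge_pred_iff: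
  "CARD('v) - 1 \<le> stability f \<longleftrightarrow> (\<forall>x u v. f x u \<noteq> x u \<longrightarrow> f x v \<noteq> x v \<longrightarrow> u = v)"
  for f :: "('v::finite) config \<Rightarrow> 'v config"
proof -
  have "CARD('v) - 1 \<le> CARD('v) - hamming_dist x (f x)
      \<longleftrightarrow> (\<forall>u v. f x u \<noteq> x u \<longrightarrow> f x v \<noteq> x v \<longrightarrow> u = v)" for x
  proof -
    have "0 < CARD('v)" by simp
    \<comment> \<open>For n = 1 the left side is true of any distance, so the bound of the distance
      by n is what gives the right side.\<close>
    then have "CARD('v) - 1 \<le> CARD('v) - hamming_dist x (f x) \<longleftrightarrow> hamming_dist x (f x) \<le> 1"
      using hamming_dist_le[of x "f x"] by linarith
    also have "\<dots> \<longleftrightarrow> (\<forall>u v. f x u \<noteq> x u \<longrightarrow> f x v \<noteq> x v \<longrightarrow> u = v)"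
      unfolding hamming_dist_def by (auto simp: card_le_Suc0_iff_eq)
    finally show ?thesis .
  qed
  then show ?thesis by (simp add: stability_ge_iff)
qed

lemma stability_eq_card_iff: "stability f = CARD('v) \<longleftrightarrow> f = id"
  for f :: "('v::finite) config \<Rightarrow> 'v config"
proof -
  have "CARD('v) \<le> CARD('v) - hamming_dist x (f x) \<longleftrightarrow> f x = x" for x
  proof -
    have "0 < CARD('v)" by simp
    then have "CARD('v) \<le> CARD('v) - hamming_dist x (f x) \<longleftrightarrow> hamming_dist x (f x) = 0"
      by linarith
    also have "\<dots> \<longleftrightarrow> f x = x"
      unfolding hamming_dist_def by (auto simp: fun_eq_iff)
    finally show ?thesis .
  qed
  then have "CARD('v) \<le> stability f \<longleftrightarrow> f = id"
    by (auto simp: stability_ge_iff fun_eq_iff)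
  then show ?thesis using stability_le[of f] by auto
qed

lemma interaction_graph_id: "interaction_graph id = add_loops {}"
proof -
  have "(v, v) \<in> interaction_graph id" for v :: 'a
    by (rule interaction_graphI) simp
  moreover have "u = v" if "(u, v) \<in> interaction_graph id" for u v :: 'a
    using that by (auto simp: interaction_graph_def)
  ultimately show ?thesis by (auto simp: add_loops_def)
qed

text \<open>Only the identity reaches stability n, and its interaction graph consists of the loops
  alone. So the maximum is n for empty \<open>E\<close> and at most n - 1 otherwise.\<close>

lemma max_mono_stability_eq_pred_iff:
  fixes E :: "('v::finite) graph"
  assumes "loopless E"
  shows "max_mono_stability (add_loops E) = CARD('v) - 1 \<longleftrightarrow>
    E \<noteq> {} \<and> (\<exists>f\<in>mono_networks (add_loops E). \<forall>x u v. f x u \<noteq> x u \<longrightarrow> f x v \<noteq> x v \<longrightarrow> u = v)"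
proof (cases "E = {}")
  case True
  have "id \<in> mono_networks (add_loops E)"
    by (simp add: True mono_networks_def interaction_graph_id mono_def)
  then have "stability (id :: 'v config \<Rightarrow> 'v config) \<le> max_mono_stability (add_loops E)"
    unfolding max_mono_stability_def by (intro Max_ge imageI finite_imageI finite_mono_networks)
  moreover have "stability (id :: 'v config \<Rightarrow> 'v config) = CARD('v)"
    by (simp add: stability_eq_card_iff)
  moreover have "0 < CARD('v)" by simp
  ultimately have "max_mono_stability (add_loops E) \<noteq> CARD('v) - 1" by linarith
  then show ?thesis using True by blast
next
  case False
  let ?M = "mono_networks (add_loops E)"
  have le: "stability f \<le> CARD('v) - 1" if "f \<in> ?M" for f
  proof -
    have "f \<noteq> id"
    proof
      assume "f = id"
      then have "add_loops E = add_loops {}"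
        using that by (simp add: mono_networks_def interaction_graph_id)
      moreover obtain u v where "(u, v) \<in> E" "u \<noteq> v"
        using False assms by (auto simp: loopless_def)
      ultimately show False
        unfolding add_loops_def by blast
    qed
    then show ?thesis
      using stability_le[of f] stability_eq_card_iff[of f] by linarith
  qed
  have "max_mono_stability (add_loops E) = CARD('v) - 1
      \<longleftrightarrow> CARD('v) - 1 \<in> stability ` ?M"
    unfolding max_mono_stability_def
    using le mono_networks_nonempty[of "add_loops E"]
    by (subst Max_eq_iff) auto
  also have "\<dots> \<longleftrightarrow> (\<exists>f\<in>?M. CARD('v) - 1 \<le> stability f)"
    unfolding image_iff using le by (metis antisym order_refl)
  finally show ?thesis using False by (simp only: stability_ge_pred_iff) simp
qed

section \<open>From a single unstable coordinate to a near-biclique\<close>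

context
  fixes E :: "('v::finite) graph" and f :: "'v config \<Rightarrow> 'v config"
  assumes f: "f \<in> mono_networks (add_loops E)"
begin

lemma mono_network_agree:
  assumes "x v = y v" and "\<And>u. u \<in> in_nbhd E v \<Longrightarrow> x u = y u"
  shows "f x v = f y v"
proof (rule interaction_graph_agree[of v f x y])
  fix u assume "(u, v) \<in> interaction_graph f"
  then have "u = v \<or> u \<in> in_nbhd E v"
    using f by (auto simp: mono_networks_def add_loops_def in_nbhd_def)
  then show "x u = y u" using assms by blast
qed

text \<open>Monotonicity carries the value 1 from \<open>x\<close> to \<open>sup x z\<close>, which
  agrees with \<open>z\<close> at \<open>v\<close>, where \<open>x\<close> is 0, and on the
  in-neighbours, where both are 1.\<close>

lemma mono_network_push_up:
  assumes "\<not> x v" "f x v" and "\<And>u. u \<in> in_nbhd E v \<Longrightarrow> z u"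
  shows "f z v"
proof -
  have "f (sup x z) v"
    using f assms(2) mono_configD[of f x "sup x z"] by (simp add: mono_networks_def)
  then show ?thesis
    using assms mono_network_agree[of "sup x z" v z] by simp
qed

lemma mono_network_push_down:
  assumes "x v" "\<not> f x v" and "\<And>u. u \<in> in_nbhd E v \<Longrightarrow> \<not> z u"
  shows "\<not> f z v"
proof
  assume "f z v"
  then have "f (inf x z) v"
    using assms mono_network_agree[of "inf x z" v z] by simp
  then have "f x v"
    using f mono_configD[of f "inf x z" x] by (simp add: mono_networks_def)
  with assms show False by simp
qed

lemma near_biclique_if_single_unstable:
  assumes "loopless E"
    and single: "\<And>x u v. f x u \<noteq> x u \<Longrightarrow> f x v \<noteq> x v \<Longrightarrow> u = v"
  shows "near_biclique E"
proof -
  define A where "A = {v. v \<notin> sources E \<and> (\<exists>x. \<not> x v \<and> f x v)}"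
  define B where "B = {v. v \<notin> sources E \<and> v \<notin> A}"
  have irrefl: "v \<notin> in_nbhd E v" for v
    using assms by (simp add: loopless_def in_nbhd_def)
  have up: "f z a" if "a \<in> A" "\<And>u. u \<in> in_nbhd E a \<Longrightarrow> z u" for a z
    using that mono_network_push_up unfolding A_def by blast
  have down: "\<not> f z b" if "b \<in> B" "\<And>u. u \<in> in_nbhd E b \<Longrightarrow> \<not> z u" for b z
  proof -
    \<comment> \<open>Membership in \<open>B\<close> only excludes being pushed up. But toggling an
      in-neighbour \<open>u\<close> can change the image at \<open>b\<close> while \<open>b\<close>
      keeps its value, so \<open>b\<close> is unstable somewhere, hence pushed down there.\<close>
    obtain u where u: "(u, b) \<in> E"
      using \<open>b \<in> B\<close> by (auto simp: B_def sources_def in_nbhd_def)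
    then have "u \<noteq> b" using assms by (auto simp: loopless_def)
    have "(u, b) \<in> interaction_graph f"
      using f u by (auto simp: mono_networks_def add_loops_def)
    then obtain x y where "\<forall>w. w \<noteq> u \<longrightarrow> x w = y w" "f x b \<noteq> f y b"
      by (auto simp: interaction_graph_def)
    then obtain x' where "f x' b \<noteq> x' b"
      using \<open>u \<noteq> b\<close> by metis
    then have "x' b" "\<not> f x' b"
      using that(1) by (auto simp: A_def B_def)
    then show ?thesis using that(2) mono_network_push_down by blast
  qed
  have AA: "(a1, a2) \<in> E \<or> (a2, a1) \<in> E" if "a1 \<in> A" "a2 \<in> A" "a1 \<noteq> a2" for a1 a2
  proof (rule ccontr)
    assume *: "\<not> ((a1, a2) \<in> E \<or> (a2, a1) \<in> E)"
    \<comment> \<open>Only \<open>a1\<close> and \<open>a2\<close> are 0 and neither is an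
      in-neighbour of the other, so both are pushed up.\<close>
    let ?z = "\<lambda>w. w \<noteq> a1 \<and> w \<noteq> a2"
    have "f ?z a1" "f ?z a2"
      using * irrefl by (auto intro!: up that simp: in_nbhd_def)
    then show False using single[of ?z a1 a2] that by simp
  qed
  have BB: "(b1, b2) \<in> E \<or> (b2, b1) \<in> E" if "b1 \<in> B" "b2 \<in> B" "b1 \<noteq> b2" for b1 b2
  proof (rule ccontr)
    assume *: "\<not> ((b1, b2) \<in> E \<or> (b2, b1) \<in> E)"
    let ?z = "\<lambda>w. w = b1 \<or> w = b2"
    have "\<not> f ?z b1" "\<not> f ?z b2"
      using * irrefl by (intro down that; auto simp: in_nbhd_def)+
    then show False using single[of ?z b1 b2] that by simp
  qed
  have AB: "\<exists>w. w \<in> in_nbhd E a \<inter> in_nbhd E b" if "a \<in> A" "b \<in> B" for a b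
  proof (rule ccontr)
    assume *: "\<nexists>w. w \<in> in_nbhd E a \<inter> in_nbhd E b"
    \<comment> \<open>Here \<open>a\<close> is 0 with all in-neighbours 1, and \<open>b\<close> is 1
      with all in-neighbours 0, by disjointness and the absence of loops.\<close>
    let ?z = "\<lambda>w. w \<in> in_nbhd E a \<or> w = b"
    have "a \<noteq> b" using that by (auto simp: B_def)
    moreover have "f ?z a" by (rule up[OF that(1)]) simp
    moreover have "\<not> f ?z b" using * irrefl by (intro down that) auto
    ultimately show False
      using single[of ?z a b] irrefl by simp
  qed
  have common: "\<exists>w. w \<in> (in_nbhd E u \<union> {u}) \<inter> (in_nbhd E v \<union> {v})"
    if "u \<in> UNIV - sources E" "v \<in> UNIV - sources E" for u v
  proof -
    \<comment> \<open>Within a class the tail of an arc joining \<open>u\<close> and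
      \<open>v\<close> is the common element; across classes it is the common in-neighbour.\<close>
    have "u \<in> A \<or> u \<in> B" "v \<in> A \<or> v \<in> B" using that by (auto simp: B_def)
    then consider "u = v" | "u \<in> A" "v \<in> A" "u \<noteq> v" | "u \<in> B" "v \<in> B" "u \<noteq> v"
      | "u \<in> A" "v \<in> B" | "v \<in> A" "u \<in> B" by blast
    then show ?thesis
    proof cases
      case 2 then show ?thesis using AA[of u v] by (auto simp: in_nbhd_def)
    next
      case 3 then show ?thesis using BB[of u v] by (auto simp: in_nbhd_def)
    next
      case 4 then show ?thesis using AB[of u v] by auto
    next
      case 5 then show ?thesis using AB[of v u] by auto
    qed auto
  qed
  have "A \<union> B \<union> sources E = UNIV" "A \<inter> B = {}" "A \<inter> sources E = {}" "B \<inter> sources E = {}"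
    by (auto simp: A_def B_def)
  then show ?thesis
    unfolding near_biclique_def using assms(1) AA BB AB common
    by (intro conjI, blast, rule_tac x = A in exI, rule_tac x = B in exI,
        rule_tac x = "sources E" in exI, intro conjI ballI impI) (assumption | blast)+
qed

end

section \<open>From a near-biclique to a network\<close>

definition biclique_network :: "'v graph \<Rightarrow> 'v set \<Rightarrow> 'v config \<Rightarrow> 'v config" where
  "biclique_network E A x v \<longleftrightarrow>
     (if v \<in> sources E then x v
      else if v \<in> A then x v \<or> (\<forall>u\<in>in_nbhd E v. x u)
      else x v \<and> (\<exists>u\<in>in_nbhd E v. x u))"

lemma biclique_network_mono_networks:
  assumes "loopless E"
  shows "biclique_network E A \<in> mono_networks (add_loops E)"
proof -
  let ?f = "biclique_network E A"
  have "mono ?f"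
    by (auto simp: mono_def le_fun_def biclique_network_def split: if_splits)
  moreover have "(u, v) \<in> E" if "(u, v) \<in> interaction_graph ?f" "u \<noteq> v" for u v
  proof (rule ccontr)
    assume "(u, v) \<notin> E"
    from that(1) obtain x y where xy: "\<forall>w. w \<noteq> u \<longrightarrow> x w = y w" "?f x v \<noteq> ?f y v"
      by (auto simp: interaction_graph_def)
    have eq: "x v = y v" and nbhd: "\<forall>w\<in>in_nbhd E v. x w = y w"
      using xy(1) \<open>u \<noteq> v\<close> \<open>(u, v) \<notin> E\<close> by (auto simp: in_nbhd_def)
    have "(\<forall>w\<in>in_nbhd E v. x w) = (\<forall>w\<in>in_nbhd E v. y w)"
      "(\<exists>w\<in>in_nbhd E v. x w) = (\<exists>w\<in>in_nbhd E v. y w)"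
      using nbhd by auto
    with eq have "?f x v = ?f y v"
      by (simp only: biclique_network_def)
    then show False
      using xy(2) by simp
  qed
  moreover have "(v, v) \<in> interaction_graph ?f" for v
  proof (rule interaction_graphI)
    \<comment> \<open>The in-neighbours of a non-source are all 0 on \<open>A\<close> and all 1
      elsewhere, so the image at \<open>v\<close> equals its own value. Sources need their own case
      in the definition: an empty conjunction or disjunction would make them constant and lose the
      loop.\<close>
    show "?f ((\<lambda>_. v \<notin> A)(v := True)) v \<noteq> ?f ((\<lambda>_. v \<notin> A)(v := False)) v"
      using assms by (auto simp: biclique_network_def sources_def loopless_def in_nbhd_def)
  qed
  moreover have "(u, v) \<in> interaction_graph ?f" if "(u, v) \<in> E" for u v
  proof (rule interaction_graphI)
    \<comment> \<open>The values at \<open>v\<close> and at the in-neighbours other than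
      \<open>u\<close> are neutral for the conjunction or disjunction, so the image at
      \<open>v\<close> is the value of \<open>u\<close>.\<close>
    let ?x = "\<lambda>w. if w = v then v \<notin> A else v \<in> A"
    have "v \<notin> sources E" "u \<noteq> v" "u \<in> in_nbhd E v"
      using that assms by (auto simp: sources_def in_nbhd_def loopless_def)
    then show "?f (?x(u := True)) v \<noteq> ?f (?x(u := False)) v"
      using assms by (auto simp: biclique_network_def loopless_def in_nbhd_def)
  qed
  ultimately show ?thesis by (auto simp: mono_networks_def add_loops_def)
qed

text \<open>An unstable vertex is a 0 in \<open>A\<close> with all in-neighbours 1 or a 1 in
  \<open>B\<close> with all in-neighbours 0. For two of them, the tail of an arc inside a class, or
  a common in-neighbour across classes, would be both 0 and 1.\<close>

lemma biclique_network_single_unstable: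
  assumes cover: "A \<union> B \<union> sources E = UNIV"
    and AA: "\<And>u v. \<lbrakk>u \<in> A; v \<in> A; u \<noteq> v\<rbrakk> \<Longrightarrow> (u, v) \<in> E \<or> (v, u) \<in> E"
    and BB: "\<And>u v. \<lbrakk>u \<in> B; v \<in> B; u \<noteq> v\<rbrakk> \<Longrightarrow> (u, v) \<in> E \<or> (v, u) \<in> E"
    and AB: "\<And>a b. \<lbrakk>a \<in> A; b \<in> B\<rbrakk> \<Longrightarrow> \<exists>w. w \<in> in_nbhd E a \<inter> in_nbhd E b"
    and "biclique_network E A x u \<noteq> x u" "biclique_network E A x v \<noteq> x v"
  shows "u = v"
proof -
  have unstable: "w \<in> A \<and> \<not> x w \<and> (\<forall>p. (p, w) \<in> E \<longrightarrow> x p)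
      \<or> w \<in> B \<and> x w \<and> (\<forall>p. (p, w) \<in> E \<longrightarrow> \<not> x p)"
    if "biclique_network E A x w \<noteq> x w" for w
    using that cover by (auto simp: biclique_network_def in_nbhd_def split: if_splits)
  have AB': "\<exists>w. (w, a) \<in> E \<and> (w, b) \<in> E" if "a \<in> A" "b \<in> B" for a b
    using AB[OF that] by (simp add: in_nbhd_def)
  show ?thesis
    using unstable[OF assms(5)] unstable[OF assms(6)] AA[of u v] BB[of u v] AB'[of u v] AB'[of v u]
    by metis
qed

theorem theorem3p13:
  fixes E :: "('v::finite) graph"
  assumes "loopless E"
  shows "max_mono_stability (add_loops E) = CARD('v) - 1 \<longleftrightarrow> E \<noteq> {} \<and> near_biclique E"
proof -
  have "\<exists>f\<in>mono_networks (add_loops E). \<forall>x u v. f x u \<noteq> x u \<longrightarrow> f x v \<noteq> x v \<longrightarrow> u = v"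
    if nb: "near_biclique E"
  proof -
    from nb obtain A B S where S: "S = sources E" and cover: "A \<union> B \<union> S = UNIV"
      and AA: "\<forall>u\<in>A. \<forall>v\<in>A. u \<noteq> v \<longrightarrow> (u, v) \<in> E \<or> (v, u) \<in> E"
      and BB: "\<forall>u\<in>B. \<forall>v\<in>B. u \<noteq> v \<longrightarrow> (u, v) \<in> E \<or> (v, u) \<in> E"
      and AB: "\<forall>a\<in>A. \<forall>b\<in>B. \<exists>w. w \<in> in_nbhd E a \<inter> in_nbhd E b"
      unfolding near_biclique_def by (elim conjE exE) (rule that; assumption)
    have "u = v"
      if "biclique_network E A x u \<noteq> x u" "biclique_network E A x v \<noteq> x v" for x u v
      by (rule biclique_network_single_unstable[OF cover[unfolded S] _ _ _ that])
        (use AA BB AB in simp_all)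
    then show ?thesis
      using biclique_network_mono_networks[OF assms] by blast
  qed
  moreover have "near_biclique E"
    if "\<exists>f\<in>mono_networks (add_loops E). \<forall>x u v. f x u \<noteq> x u \<longrightarrow> f x v \<noteq> x v \<longrightarrow> u = v"
    using that near_biclique_if_single_unstable[OF _ assms] by blast
  ultimately show ?thesis
    using max_mono_stability_eq_pred_iff[OF assms] by blast
qed

end
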